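(* Let $d\ge 1$ be the dimension of the uncertainty parameter space, let $a>0$ and $\lambda>1$, and let $\frac{a}{\lambda}=r_1<r_2<\cdots<r_m=a$ be an arbitrary grid (arbitrary number $m$ of points, arbitrarily placed) of the interval $[\frac{a}{\lambda},a]$ of uncertainty radii. Then the equivalent number of grid points $m_{\mathrm{eq}}$ of the sample reuse scheme on this grid satisfies $$m_{\mathrm{eq}} < 1 + d\,\ln\lambda .$$
   Context: Uncertainty sets. The uncertainty lives in $\mathbb{R}^d$. The set $\mathcal{B}_1\subset\mathbb{R}^d$ is Lebesgue measurable with $0<\mathrm{vol}(\mathcal{B}_1)<\infty$ and is star-shaped: $cX\in\mathcal{B}_1$ for all $X\in\mathcal{B}_1$ and $c\in[0,1]$. For $r>0$, $\mathcal{B}_r=\{rX : X\in\mathcal{B}_1\}$ is the uncertainty bounding set of radius $r$. Sample reuse scheme. Fix a sample size $N\ge 1$ and a grid $r_1<\cdots<r_m$. Process the radii in decreasing order $i=m,m-1,\dots,1$. At radius $r_i$, all samples generated previously (for radii $r_k$ with $k>i$) that happen to lie in $\mathcal{B}_{r_i}$ are reused as samples for $r_i$; then as many additional samples, drawn independently (of each other and of the past) and uniformly from $\mathcal{B}_{r_i}$, are generated as needed so that exactly $N$ samples are available for $r_i$. Let $\mathbf{n}_i$ be the (random) number of additional samples generated at radius $r_i$ (so $\mathbf{n}_m=N$), and $\boldsymbol{n}=\sum_{i=1}^m\mathbf{n}_i$ the total number of samples (simulations). The equivalent number of grid points is $m_{\mathrm{eq}}=\mathbb{E}[\boldsymbol{n}]/N$.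 *)

theory Defs
  imports "HOL-Probability.Probability"
begin

definition bounding_set :: "'a::real_vector set \<Rightarrow> real \<Rightarrow> 'a set" where
  "bounding_set B1 r = (\<lambda>x. r *\<^sub>R x) ` B1"

definition uncertainty_set :: "'a::euclidean_space set \<Rightarrow> bool" where
  "uncertainty_set B1 \<longleftrightarrow>
     B1 \<in> sets lebesgue \<and> 0 < emeasure lebesgue B1 \<and> emeasure lebesgue B1 < \<infinity> \<and>
     (\<forall>x\<in>B1. \<forall>c\<in>{0..1}. c *\<^sub>R x \<in> B1)"

text \<open>
  Randomness is supplied by a pool: \<open>x i j\<close> is the value that the \<open>j\<close>-th new sample at
  radius \<open>r i\<close> has, if that sample is generated. Radii are processed in the order
  \<open>i = m, m - 1, \<dots>, 1\<close>, so the samples existing before radius \<open>r i\<close> are the \<open>x k j\<close> with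
  \<open>i < k \<le> m\<close> and \<open>j\<close> below the number of new samples generated at \<open>r k\<close>. They are counted
  by index, that is, with multiplicity. The subtraction is on naturals;
  \<open>reused_plus_additional\<close> below shows that it never truncates.
\<close>

function additional_samples ::
  "'a::real_vector set \<Rightarrow> nat \<Rightarrow> nat \<Rightarrow> (nat \<Rightarrow> real) \<Rightarrow> (nat \<Rightarrow> nat \<Rightarrow> 'a) \<Rightarrow> nat \<Rightarrow> nat" where
  "additional_samples B1 N m r x i =
     N - (\<Sum>k\<in>{i<..m}.
            card {j \<in> {..<additional_samples B1 N m r x k}. x k j \<in> bounding_set B1 (r i)})"
  by pat_completeness auto
termination
  by (relation "Wellfounded.measure (\<lambda>(B1, N, m, r, x, i). m - i)") auto

declare additional_samples.simps [simp del]

definition reused_samples ::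
  "'a::real_vector set \<Rightarrow> nat \<Rightarrow> nat \<Rightarrow> (nat \<Rightarrow> real) \<Rightarrow> (nat \<Rightarrow> nat \<Rightarrow> 'a) \<Rightarrow> nat \<Rightarrow> nat" where
  "reused_samples B1 N m r x i =
     (\<Sum>k\<in>{i<..m}.
        card {j \<in> {..<additional_samples B1 N m r x k}. x k j \<in> bounding_set B1 (r i)})"

definition total_samples ::
  "'a::real_vector set \<Rightarrow> nat \<Rightarrow> nat \<Rightarrow> (nat \<Rightarrow> real) \<Rightarrow> (nat \<Rightarrow> nat \<Rightarrow> 'a) \<Rightarrow> nat" where
  "total_samples B1 N m r x = (\<Sum>i\<in>{1..m}. additional_samples B1 N m r x i)"

text \<open>
  At most \<open>N\<close> new samples are needed at each radius, so a pool of \<open>N\<close> per radius suffices.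
  As \<open>B1\<close> is only Lebesgue measurable, samples take values in \<^term>\<open>lebesgue\<close> rather than
  in \<^term>\<open>borel\<close>.
\<close>

definition sample_pool ::
  "'w measure \<Rightarrow> 'a::euclidean_space set \<Rightarrow> nat \<Rightarrow> nat \<Rightarrow> (nat \<Rightarrow> real) \<Rightarrow>
   (nat \<Rightarrow> nat \<Rightarrow> 'w \<Rightarrow> 'a) \<Rightarrow> bool" where
  "sample_pool M B1 N m r X \<longleftrightarrow>
     prob_space M \<and>
     prob_space.indep_vars M (\<lambda>_. lebesgue) (\<lambda>(i, j). X i j) ({1..m} \<times> {..<N}) \<and>
     (\<forall>i\<in>{1..m}. \<forall>j<N.
        distr M lebesgue (X i j) = uniform_measure lebesgue (bounding_set B1 (r i)))"

definition equivalent_grid_points ::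
  "'w measure \<Rightarrow> 'a::real_vector set \<Rightarrow> nat \<Rightarrow> nat \<Rightarrow> (nat \<Rightarrow> real) \<Rightarrow>
   (nat \<Rightarrow> nat \<Rightarrow> 'w \<Rightarrow> 'a) \<Rightarrow> real" where
  "equivalent_grid_points M B1 N m r X =
     (\<integral>\<omega>. real (total_samples B1 N m r (\<lambda>i j. X i j \<omega>)) \<partial>M) / real N"

lemma bounding_set_mono:
  assumes "uncertainty_set B1" "0 < s" "s \<le> t"
  shows "bounding_set B1 s \<subseteq> bounding_set B1 t"
proof
  fix y assume "y \<in> bounding_set B1 s"
  then obtain x where x: "x \<in> B1" "y = s *\<^sub>R x" by (auto simp: bounding_set_def)
  have "(s / t) *\<^sub>R x \<in> B1" using assms x by (auto simp: uncertainty_set_def)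
  moreover have "y = t *\<^sub>R ((s / t) *\<^sub>R x)" using assms x by simp
  ultimately show "y \<in> bounding_set B1 t" unfolding bounding_set_def by blast
qed

lemma reused_plus_additional:
  assumes B1: "uncertainty_set B1" and mono: "strict_mono_on {1..m} r" and pos: "0 < r 1"
    and i: "i \<in> {1..m}"
  shows "reused_samples B1 N m r x i + additional_samples B1 N m r x i = N"
proof -
  have "i \<le> m" "1 \<le> i" using i by auto
  then have "reused_samples B1 N m r x i \<le> N"
  proof (induction rule: inc_induct)
    case base
    show ?case by (simp add: reused_samples_def)
  next
    case (step n)
    let ?a = "additional_samples B1 N m r x"
    have "0 < r n"
      using strict_mono_onD[OF mono, of 1 n] pos step by (cases "n = 1") auto
    moreover have "r n \<le> r (Suc n)"
      using strict_mono_onD[OF mono, of n "Suc n"] step by simp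
    ultimately have sub: "bounding_set B1 (r n) \<subseteq> bounding_set B1 (r (Suc n))"
      by (rule bounding_set_mono[OF B1])
    have split: "{n<..m} = insert (Suc n) {Suc n<..m}" using step by auto
    have "reused_samples B1 N m r x n =
        card {j \<in> {..<?a (Suc n)}. x (Suc n) j \<in> bounding_set B1 (r n)} +
        (\<Sum>k\<in>{Suc n<..m}. card {j \<in> {..<?a k}. x k j \<in> bounding_set B1 (r n)})"
      unfolding reused_samples_def split by (rule sum.insert) auto
    also have "\<dots> \<le> ?a (Suc n) + reused_samples B1 N m r x (Suc n)"
      unfolding reused_samples_def
    proof (intro add_mono sum_mono card_mono)
      show "card {j \<in> {..<?a (Suc n)}. x (Suc n) j \<in> bounding_set B1 (r n)} \<le> ?a (Suc n)"
        using card_mono[of "{..<?a (Suc n)}"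
            "{j \<in> {..<?a (Suc n)}. x (Suc n) j \<in> bounding_set B1 (r n)}"] by auto
    qed (use sub in auto)
    also have "\<dots> = N"
      using step additional_samples.simps[of B1 N m r x "Suc n"]
      by (simp add: reused_samples_def)
    finally show ?case .
  qed
  then show ?thesis
    using additional_samples.simps[of B1 N m r x i] by (simp add: reused_samples_def)
qed

end

theory Submission
  imports Defs
begin

text \<open>
  The number of new samples at a radius is a function of the samples at larger radii, hence
  independent of the samples drawn at that radius. Writing \<open>A i\<close> for its expectation and
  \<open>d\<close> for the dimension, this turns the reuse rule into
  \<open>A i + (\<Sum>k\<in>{i<..m}. A k * (r i / r k) ^ d) = N\<close>. Dividing by \<open>r i ^ d\<close> and subtracting
  consecutive equations gives \<open>A m = N\<close> and \<open>A i = N * (1 - (r i / r (i + 1)) ^ d)\<close> for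
  \<open>i < m\<close>. Finally \<open>1 - x < - ln x\<close> for \<open>0 < x < 1\<close>, and the logarithms telescope to
  \<open>d * ln (r m / r 1)\<close>.
\<close>

section \<open>Counting new samples: bound, dependence on the pool, measurability\<close>

lemma additional_samples_le: "additional_samples B1 N m r x i \<le> N"
  by (subst additional_samples.simps) simp

text \<open>Moves a possibly random bound \<open>n\<close> from the index range into the summands.
  The range \<open>{..<N}\<close> is then fixed, so measurability and linearity of expectation apply
  termwise.\<close>

lemma card_accepted_eq_sum:
  fixes n N :: nat
  assumes "n \<le> N"
  shows "card {j \<in> {..<n}. P j} = (\<Sum>j<N. if j < n \<and> P j then 1 else 0)"
proof -
  have "{j \<in> {..<n}. P j} = {..<N} \<inter> {j. j < n \<and> P j}" using assms by auto
  then show ?thesis by (simp add: sum.If_cases)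
qed

text \<open>The recursion for radius \<open>i\<close> reads the pool only at larger radii, and only
  below \<open>N\<close> because no radius asks for more than \<open>N\<close> new samples. This
  locality is the source of the independence used later.\<close>

lemma additional_samples_cong:
  assumes "\<And>k j. i < k \<Longrightarrow> k \<le> m \<Longrightarrow> j < N \<Longrightarrow> x k j = y k j"
  shows "additional_samples B1 N m r x i = additional_samples B1 N m r y i"
  using assms
proof (induction "m - i" arbitrary: i rule: less_induct)
  case less
  have "additional_samples B1 N m r x k = additional_samples B1 N m r y k"
    if "k \<in> {i<..m}" for k
    using that by (intro less.hyps) (auto intro!: less.prems)
  moreover have "x k j = y k j" if "k \<in> {i<..m}" "j < additional_samples B1 N m r y k" for k j
    using that additional_samples_le[of B1 N m r y k] by (intro less.prems) auto
  ultimately have "(\<Sum>k\<in>{i<..m}.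
        card {j \<in> {..<additional_samples B1 N m r x k}. x k j \<in> bounding_set B1 (r i)}) =
      (\<Sum>k\<in>{i<..m}.
        card {j \<in> {..<additional_samples B1 N m r y k}. y k j \<in> bounding_set B1 (r i)})"
    by (intro sum.cong arg_cong[where f = card]) auto
  then show ?case by (simp add: additional_samples.simps[of _ _ _ _ _ i])
qed

text \<open>The domain \<open>M\<close> is arbitrary so that the lemma serves both the probability
  space and the product space of sample tuples.\<close>

lemma measurable_additional_samples:
  assumes B: "\<And>k. i \<le> k \<Longrightarrow> k \<le> m \<Longrightarrow> bounding_set B1 (r k) \<in> sets S"
    and Y: "\<And>k j. i < k \<Longrightarrow> k \<le> m \<Longrightarrow> j < N \<Longrightarrow> Y k j \<in> M \<rightarrow>\<^sub>M S"
  shows "(\<lambda>\<omega>. additional_samples B1 N m r (\<lambda>k j. Y k j \<omega>) i) \<in> M \<rightarrow>\<^sub>M count_space UNIV"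
  using assms
proof (induction "m - i" arbitrary: i rule: less_induct)
  case less
  show ?case
  proof (cases "i < m")
    case False
    then show ?thesis by (subst additional_samples.simps) simp
  next
    case True
    have [measurable]: "bounding_set B1 (r i) \<in> sets S" using True by (intro less.prems) auto
    have [measurable]:
      "(\<lambda>\<omega>. additional_samples B1 N m r (\<lambda>k j. Y k j \<omega>) k) \<in> M \<rightarrow>\<^sub>M count_space UNIV"
      if "k \<in> {i<..m}" for k
      using that by (intro less.hyps) (auto intro!: less.prems)
    have Ym[measurable]: "Y k j \<in> M \<rightarrow>\<^sub>M S" if "k \<in> {i<..m}" "j \<in> {..<N}" for k j
      using that by (intro less.prems) auto
    show ?thesis
      by (subst additional_samples.simps)
        (simp only: card_accepted_eq_sum[OF additional_samples_le], measurable)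
  qed
qed

section \<open>Volumes of the bounding sets\<close>

lemma sets_bounding_set:
  fixes B1 :: "'a::euclidean_space set"
  assumes "B1 \<in> sets lebesgue" "0 < s"
  shows "bounding_set B1 s \<in> sets lebesgue"
proof -
  \<comment> \<open>The image under scaling by \<open>s\<close> is the preimage under scaling by
    \<open>1 / s\<close>, and preimages under a measurable map are measurable.\<close>
  have "bounding_set B1 s = (*\<^sub>R) (1 / s) -` B1 \<inter> space lebesgue"
    using assms(2) by (force simp: bounding_set_def image_iff)
  also have "\<dots> \<in> sets lebesgue"
    using assms(1) by (intro measurable_sets[OF lebesgue_measurable_scaling])
  finally show ?thesis .
qed

text \<open>Scaling by \<open>u\<close> multiplies volume by \<open>u ^ DIM('a)\<close>, and
  star-shapedness nests the two sets, so the conditional volume is a plain quotient in which the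
  volume of \<open>B1\<close> cancels.\<close>

lemma measure_bounding_set_ratio:
  fixes B1 :: "'a::euclidean_space set"
  assumes B1: "uncertainty_set B1" and st: "0 < s" "s \<le> t"
  shows "measure (uniform_measure lebesgue (bounding_set B1 t)) (bounding_set B1 s) =
    (s / t) ^ DIM('a)"
proof -
  have e: "emeasure lebesgue (bounding_set B1 u) = ennreal (u ^ DIM('a)) * emeasure lebesgue B1"
    and me: "measure lebesgue (bounding_set B1 u) = u ^ DIM('a) * measure lebesgue B1"
    if "0 < u" for u
    using that emeasure_lebesgue_affine[of u 0 B1] measure_lebesgue_affine[of u 0 B1]
    by (simp_all add: bounding_set_def ennreal_power)
  have t: "0 < t" using st by simp
  have nz: "emeasure lebesgue B1 \<noteq> 0" "emeasure lebesgue B1 < \<infinity>"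
    using B1 by (auto simp: uncertainty_set_def)
  then have "measure lebesgue B1 \<noteq> 0"
    by (simp add: measure_def enn2real_eq_0_iff)
  moreover have "bounding_set B1 t \<inter> bounding_set B1 s = bounding_set B1 s"
    using bounding_set_mono[OF B1 st] by blast
  moreover have "bounding_set B1 s \<in> sets lebesgue"
    using B1 st by (intro sets_bounding_set) (auto simp: uncertainty_set_def)
  moreover have "emeasure lebesgue (bounding_set B1 t) \<noteq> 0"
      "emeasure lebesgue (bounding_set B1 t) \<noteq> \<infinity>"
    using e[OF t] nz t by (auto simp: ennreal_mult_eq_top_iff)
  ultimately show ?thesis
    using me[OF t] me[OF st(1)] by (simp add: power_divide)
qed

section \<open>Independence and the expected number of reused samples\<close>

locale sample_reuse =
  fixes M :: "'w measure" and B1 :: "'a::euclidean_space set" and N m :: nat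
    and r :: "nat \<Rightarrow> real" and X :: "nat \<Rightarrow> nat \<Rightarrow> 'w \<Rightarrow> 'a"
  assumes B1: "uncertainty_set B1"
    and mono: "strict_mono_on {1..m} r"
    and pos: "0 < r 1"
    and pool: "sample_pool M B1 N m r X"
begin

sublocale prob_space M
  using pool by (simp add: sample_pool_def)

abbreviation additional :: "nat \<Rightarrow> 'w \<Rightarrow> nat" where
  "additional i \<omega> \<equiv> additional_samples B1 N m r (\<lambda>k j. X k j \<omega>) i"

lemma radius_pos: "i \<in> {1..m} \<Longrightarrow> 0 < r i"
  using strict_mono_onD[OF mono, of 1 i] pos by (cases "i = 1") auto

lemma sets_bounding: "i \<in> {1..m} \<Longrightarrow> bounding_set B1 (r i) \<in> sets lebesgue"
  using B1 radius_pos by (intro sets_bounding_set) (auto simp: uncertainty_set_def)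

lemma measurable_sample: "k \<in> {1..m} \<Longrightarrow> j < N \<Longrightarrow> X k j \<in> M \<rightarrow>\<^sub>M lebesgue"
  using pool by (auto simp: sample_pool_def indep_vars_def)

lemma measurable_additional: "i \<in> {1..m} \<Longrightarrow> additional i \<in> M \<rightarrow>\<^sub>M count_space UNIV"
  by (rule measurable_additional_samples[where S = lebesgue])
    (auto intro!: measurable_sample sets_bounding)

text \<open>The count at radius \<open>k\<close> is a function of the samples at larger radii. These
  form an index block disjoint from \<open>(k, j)\<close>, and restrictions of an independent family
  to disjoint blocks are independent.\<close>

lemma prob_additional_sample:
  assumes k: "k \<in> {1..m}" and j: "j < N" and S: "S \<in> sets lebesgue"
  shows "prob {\<omega> \<in> space M. additional k \<omega> \<in> T \<and> X k j \<omega> \<in> S} =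
    prob {\<omega> \<in> space M. additional k \<omega> \<in> T} * prob {\<omega> \<in> space M. X k j \<omega> \<in> S}"
proof -
  let ?A = "{k<..m} \<times> {..<N}" and ?B = "{(k, j)}"
  let ?Z = "\<lambda>(i, j). X i j"
  let ?f = "\<lambda>g. additional_samples B1 N m r (\<lambda>i j. g (i, j)) k"
  let ?FA = "\<lambda>\<omega>. \<lambda>i\<in>?A. ?Z i \<omega>" and ?FB = "\<lambda>\<omega>. \<lambda>i\<in>?B. ?Z i \<omega>"
  let ?PA = "PiM ?A (\<lambda>_. lebesgue)" and ?PB = "PiM ?B (\<lambda>_. lebesgue)"
  have ind: "indep_var ?PA ?FA ?PB ?FB"
    using pool k j by (intro indep_var_restrict[of _ ?Z]) (auto simp: sample_pool_def)
  have "?f \<in> ?PA \<rightarrow>\<^sub>M count_space UNIV"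
    using k by (intro measurable_additional_samples[where S = lebesgue] sets_bounding
        measurable_component_singleton) auto
  then have "?f -` T \<inter> space ?PA \<in> sets ?PA"
    by (rule measurable_sets) simp
  moreover have "(\<lambda>g. g (k, j)) -` S \<inter> space ?PB \<in> sets ?PB"
    by (rule measurable_sets[OF _ S]) (rule measurable_component_singleton, simp)
  ultimately have indep: "prob ((\<lambda>\<omega>. (?FA \<omega>, ?FB \<omega>)) -`
        ((?f -` T \<inter> space ?PA) \<times> ((\<lambda>g. g (k, j)) -` S \<inter> space ?PB)) \<inter> space M) =
      prob (?FA -` (?f -` T \<inter> space ?PA) \<inter> space M) *
      prob (?FB -` ((\<lambda>g. g (k, j)) -` S \<inter> space ?PB) \<inter> space M)"
    by (rule indep_varD[OF ind])
  \<comment> \<open>The restricted tuple is \<open>undefined\<close> outside \<open>?A\<close>, but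
    the count at \<open>k\<close> never reads those entries.\<close>
  have "?f (?FA \<omega>) = additional k \<omega>" for \<omega>
    by (rule additional_samples_cong) auto
  moreover have "?FA \<omega> \<in> space ?PA" "?FB \<omega> \<in> space ?PB" for \<omega>
    by (auto simp: space_PiM)
  ultimately have
    "(\<lambda>\<omega>. (?FA \<omega>, ?FB \<omega>)) -`
        ((?f -` T \<inter> space ?PA) \<times> ((\<lambda>g. g (k, j)) -` S \<inter> space ?PB)) \<inter> space M =
      {\<omega> \<in> space M. additional k \<omega> \<in> T \<and> X k j \<omega> \<in> S}"
    "?FA -` (?f -` T \<inter> space ?PA) \<inter> space M = {\<omega> \<in> space M. additional k \<omega> \<in> T}"
    "?FB -` ((\<lambda>g. g (k, j)) -` S \<inter> space ?PB) \<inter> space M = {\<omega> \<in> space M. X k j \<omega> \<in> S}"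
    by auto
  with indep show ?thesis by (simp only:)
qed

lemma prob_sample_in_smaller:
  assumes i: "i \<in> {1..m}" and k: "k \<in> {i<..m}" and j: "j < N"
  shows "prob {\<omega> \<in> space M. X k j \<omega> \<in> bounding_set B1 (r i)} = (r i / r k) ^ DIM('a)"
proof -
  have "prob {\<omega> \<in> space M. X k j \<omega> \<in> bounding_set B1 (r i)} =
      measure (distr M lebesgue (X k j)) (bounding_set B1 (r i))"
    using i k j by (subst measure_distr)
      (auto intro!: measurable_sample sets_bounding simp: vimage_def Int_def conj_commute)
  also have "distr M lebesgue (X k j) = uniform_measure lebesgue (bounding_set B1 (r k))"
    using pool i k j by (auto simp: sample_pool_def)
  also have "measure \<dots> (bounding_set B1 (r i)) = (r i / r k) ^ DIM('a)"
    using i k radius_pos[OF i] strict_mono_onD[OF mono, of i k]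
    by (intro measure_bounding_set_ratio[OF B1]) auto
  finally show ?thesis .
qed

lemma integrable_additional: "i \<in> {1..m} \<Longrightarrow> integrable M (\<lambda>\<omega>. real (additional i \<omega>))"
  using measurable_additional[of i]
  by (intro integrable_const_bound[where B = "real N"]) (auto simp: additional_samples_le)

text \<open>The tail-sum formula for the expectation of a count that never exceeds
  \<open>N\<close>.\<close>

lemma sum_prob_less_additional:
  assumes k: "k \<in> {1..m}"
  shows "(\<Sum>j<N. prob {\<omega> \<in> space M. j < additional k \<omega>}) =
    expectation (\<lambda>\<omega>. real (additional k \<omega>))"
proof -
  note [measurable] = measurable_additional[OF k]
  have "real (additional k \<omega>) = (\<Sum>j<N. indicator {\<omega> \<in> space M. j < additional k \<omega>} \<omega>)"
    if "\<omega> \<in> space M" for \<omega>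
  proof -
    have "real (additional k \<omega>) = real (card {j \<in> {..<additional k \<omega>}. True})"
      by simp
    also have "\<dots> = (\<Sum>j<N. indicator {\<omega> \<in> space M. j < additional k \<omega>} \<omega>)"
      unfolding card_accepted_eq_sum[OF additional_samples_le] of_nat_sum using that
      by (intro sum.cong) (auto simp: indicator_def)
    finally show ?thesis .
  qed
  then have "expectation (\<lambda>\<omega>. real (additional k \<omega>)) =
      expectation (\<lambda>\<omega>. \<Sum>j<N. indicator {\<omega> \<in> space M. j < additional k \<omega>} \<omega>)"
    by (intro Bochner_Integration.integral_cong) auto
  also have "\<dots> = (\<Sum>j<N. prob {\<omega> \<in> space M. j < additional k \<omega>})"
    by (subst Bochner_Integration.integral_sum) (auto simp: emeasure_eq_measure)
  finally show ?thesis ..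
qed

text \<open>An identity of Wald type: whether the \<open>j\<close>-th new sample is generated is
  independent of where it falls, so each term factors, and the tail sum restores the expected
  count.\<close>

lemma expectation_reused:
  assumes i: "i \<in> {1..m}" and k: "k \<in> {i<..m}"
  defines "C \<equiv> \<lambda>\<omega>. real (card {j \<in> {..<additional k \<omega>}. X k j \<omega> \<in> bounding_set B1 (r i)})"
  shows "integrable M C"
    and "expectation C = expectation (\<lambda>\<omega>. real (additional k \<omega>)) * (r i / r k) ^ DIM('a)"
proof -
  let ?E = "\<lambda>j. {\<omega> \<in> space M. j < additional k \<omega> \<and> X k j \<omega> \<in> bounding_set B1 (r i)}"
  have k': "k \<in> {1..m}" using i k by auto
  note [measurable] = measurable_additional[OF k'] sets_bounding[OF i]
  have E: "?E j \<in> events" if "j < N" for j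
  proof -
    note [measurable] = measurable_sample[OF k' that]
    show ?thesis by measurable
  qed
  have C: "C \<omega> = (\<Sum>j<N. indicator (?E j) \<omega>)" if "\<omega> \<in> space M" for \<omega>
    unfolding C_def card_accepted_eq_sum[OF additional_samples_le] of_nat_sum using that
    by (intro sum.cong) (auto simp: indicator_def)
  have "integrable M (\<lambda>\<omega>. \<Sum>j<N. indicator (?E j) \<omega> :: real)"
    using E by (auto simp: emeasure_eq_measure)
  then show "integrable M C"
    by (subst Bochner_Integration.integrable_cong[OF refl C])
  have prob: "prob (?E j) = prob {\<omega> \<in> space M. j < additional k \<omega>} * (r i / r k) ^ DIM('a)"
    if "j < N" for j
  proof -
    have "prob (?E j) = prob {\<omega> \<in> space M. j < additional k \<omega>} *
        prob {\<omega> \<in> space M. X k j \<omega> \<in> bounding_set B1 (r i)}"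
      \<comment> \<open>Membership of the count in \<open>{j<..}\<close> says that the
        \<open>j\<close>-th new sample is generated.\<close>
      using prob_additional_sample[OF k' that sets_bounding[OF i], of "{j<..}"] by simp
    then show ?thesis using prob_sample_in_smaller[OF i k that] by simp
  qed
  have "expectation C = expectation (\<lambda>\<omega>. \<Sum>j<N. indicator (?E j) \<omega>)"
    using C by (intro Bochner_Integration.integral_cong) auto
  also have "\<dots> = (\<Sum>j<N. prob (?E j))"
    using E by (subst Bochner_Integration.integral_sum)
      (auto simp: emeasure_eq_measure Int_absorb1 subset_eq)
  also have "\<dots> = (\<Sum>j<N. prob {\<omega> \<in> space M. j < additional k \<omega>} * (r i / r k) ^ DIM('a))"
    using prob by (intro sum.cong) auto
  also have "\<dots> = expectation (\<lambda>\<omega>. real (additional k \<omega>)) * (r i / r k) ^ DIM('a)"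
    unfolding sum_prob_less_additional[OF k', symmetric] by (simp add: sum_distrib_right)
  finally show "expectation C =
    expectation (\<lambda>\<omega>. real (additional k \<omega>)) * (r i / r k) ^ DIM('a)" .
qed

section \<open>Expected number of new samples at each radius\<close>

lemma expectation_balance:
  assumes i: "i \<in> {1..m}"
  shows "(\<Sum>k\<in>{i..m}. expectation (\<lambda>\<omega>. real (additional k \<omega>)) / r k ^ DIM('a)) =
    real N / r i ^ DIM('a)"
proof -
  let ?C = "\<lambda>k \<omega>. real (card {j \<in> {..<additional k \<omega>}. X k j \<omega> \<in> bounding_set B1 (r i)})"
  let ?e = "\<lambda>k. expectation (\<lambda>\<omega>. real (additional k \<omega>))"
  \<comment> \<open>Subtraction over the reals is legitimate here because the reused samples never
    exceed \<open>N\<close>.\<close>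
  have "real (additional i \<omega>) = real N - (\<Sum>k\<in>{i<..m}. ?C k \<omega>)" for \<omega>
    using reused_plus_additional[OF B1 mono pos i, of N "\<lambda>k j. X k j \<omega>"]
    by (simp add: reused_samples_def flip: of_nat_sum)
  then have "?e i = expectation (\<lambda>\<omega>. real N - (\<Sum>k\<in>{i<..m}. ?C k \<omega>))"
    by simp
  also have "\<dots> = real N - (\<Sum>k\<in>{i<..m}. expectation (?C k))"
    using expectation_reused(1)[OF i]
    by (subst Bochner_Integration.integral_diff, simp_all only: integrable_const
        Bochner_Integration.integrable_sum Bochner_Integration.integral_sum)
      (simp add: prob_space)
  also have "\<dots> = real N - (\<Sum>k\<in>{i<..m}. ?e k * (r i / r k) ^ DIM('a))"
    using expectation_reused(2)[OF i] by simp
  \<comment> \<open>Division by \<open>r i ^ DIM('a)\<close> removes \<open>i\<close> from the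
    summands, so the left sides of consecutive balances differ by a single term.\<close>
  finally have "?e i / r i ^ DIM('a) = real N / r i ^ DIM('a) -
      (\<Sum>k\<in>{i<..m}. ?e k * (r i / r k) ^ DIM('a) / r i ^ DIM('a))"
    by (simp add: diff_divide_distrib sum_divide_distrib)
  moreover have "{i..m} = insert i {i<..m}" using i by auto
  ultimately show ?thesis
    using radius_pos[OF i] by (simp add: power_divide)
qed

lemma expectation_additional_last:
  assumes "1 \<le> m"
  shows "expectation (\<lambda>\<omega>. real (additional m \<omega>)) = real N"
  using expectation_balance[of m] radius_pos[of m] assms by simp

lemma expectation_additional:
  assumes i: "i \<in> {1..<m}"
  shows "expectation (\<lambda>\<omega>. real (additional i \<omega>)) =
    real N * (1 - (r i / r (Suc i)) ^ DIM('a))"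
proof -
  \<comment> \<open>Everything after the first term is the balance at \<open>Suc i\<close>, which is
    still a grid index because \<open>i < m\<close>.\<close>
  have "{i..m} = insert i {Suc i..m}" using i by auto
  then have "expectation (\<lambda>\<omega>. real (additional i \<omega>)) / r i ^ DIM('a) =
      real N / r i ^ DIM('a) - real N / r (Suc i) ^ DIM('a)"
    using expectation_balance[of i] expectation_balance[of "Suc i"] i by simp
  moreover have "0 < r i" using radius_pos[of i] i by simp
  ultimately have "expectation (\<lambda>\<omega>. real (additional i \<omega>)) =
      (real N / r i ^ DIM('a) - real N / r (Suc i) ^ DIM('a)) * r i ^ DIM('a)"
    by (simp add: nonzero_divide_eq_eq)
  with \<open>0 < r i\<close> show ?thesis by (simp add: algebra_simps power_divide)
qed

section \<open>The exact value of the equivalent number of grid points and its logarithmic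
  bound\<close>

lemma equivalent_grid_points_eq:
  assumes "1 \<le> N" "1 \<le> m"
  shows "equivalent_grid_points M B1 N m r X =
    1 + (\<Sum>i\<in>{1..<m}. 1 - (r i / r (Suc i)) ^ DIM('a))"
proof -
  have "expectation (\<lambda>\<omega>. real (total_samples B1 N m r (\<lambda>i j. X i j \<omega>))) =
      (\<Sum>i\<in>{1..m}. expectation (\<lambda>\<omega>. real (additional i \<omega>)))"
    unfolding total_samples_def of_nat_sum
    by (rule Bochner_Integration.integral_sum) (rule integrable_additional)
  also have "{1..m} = insert m {1..<m}" using assms by auto
  also have "(\<Sum>i\<in>insert m {1..<m}. expectation (\<lambda>\<omega>. real (additional i \<omega>))) =
      real N + (\<Sum>i\<in>{1..<m}. real N * (1 - (r i / r (Suc i)) ^ DIM('a)))"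
    using expectation_additional expectation_additional_last assms by simp
  finally show ?thesis
    using assms unfolding equivalent_grid_points_def
    by (simp add: add_divide_distrib flip: sum_distrib_left)
qed

text \<open>Strictness comes from having at least one gap in the grid; for \<open>m = 1\<close> both
  sides would equal 1.\<close>

lemma equivalent_grid_points_less:
  assumes N: "1 \<le> N" and m: "1 < m"
  shows "equivalent_grid_points M B1 N m r X < 1 + real DIM('a) * ln (r m / r 1)"
proof -
  have "1 - (r i / r (Suc i)) ^ DIM('a) < real DIM('a) * (ln (r (Suc i)) - ln (r i))"
    if i: "i \<in> {1..<m}" for i
  proof -
    have ri: "0 < r i" "r i < r (Suc i)"
      using radius_pos[of i] strict_mono_onD[OF mono, of i "Suc i"] i by auto
    let ?x = "(r i / r (Suc i)) ^ DIM('a)"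
    \<comment> \<open>The inequality \<open>ln x \<le> x - 1\<close> is an equality only at 1, which
      the strict increase of the radii excludes.\<close>
    have "?x \<noteq> 1"
      using ri power_strict_mono[of "r i / r (Suc i)" 1 "DIM('a)"] by auto
    moreover have "0 < ?x" using ri by simp
    ultimately have "ln ?x < ?x - 1"
      using ln_le_minus_one ln_eq_minus_one by (metis less_le)
    moreover have "ln ?x = real DIM('a) * (ln (r i) - ln (r (Suc i)))"
      using ri by (simp add: ln_realpow ln_div)
    ultimately show ?thesis by (simp add: algebra_simps)
  qed
  then have "(\<Sum>i\<in>{1..<m}. 1 - (r i / r (Suc i)) ^ DIM('a)) <
      (\<Sum>i\<in>{1..<m}. real DIM('a) * (ln (r (Suc i)) - ln (r i)))"
    using m by (intro sum_strict_mono) auto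
  also have "\<dots> = real DIM('a) * (ln (r m) - ln (r 1))"
    unfolding sum_distrib_left[symmetric]
    using m by (subst sum_Suc_diff'[of 1 m "\<lambda>i. ln (r i)"]) auto
  also have "ln (r m) - ln (r 1) = ln (r m / r 1)"
    using radius_pos[of m] pos m by (simp add: ln_div)
  finally show ?thesis using equivalent_grid_points_eq N m by simp
qed

end

theorem theorem1:
  fixes B1 :: "(real ^ 'd) set"
    and a lam :: real
    and N m :: nat
    and r :: "nat \<Rightarrow> real"
    and M :: "'w measure"
    and X :: "nat \<Rightarrow> nat \<Rightarrow> 'w \<Rightarrow> real ^ 'd"
  assumes "uncertainty_set B1"
    and "N \<ge> 1"
    and "a > 0" and "lam > 1"
    and "m \<ge> 1"
    and "strict_mono_on {1..m} r" and "r 1 = a / lam" and "r m = a"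
    and "sample_pool M B1 N m r X"
  shows "equivalent_grid_points M B1 N m r X < 1 + real CARD('d) * ln lam"
proof -
  have "0 < r 1" using assms by simp
  then interpret sample_reuse M B1 N m r X
    using assms by unfold_locales
  \<comment> \<open>A single grid point would give \<open>a / lam = a\<close>, contradicting
    \<open>lam > 1\<close>.\<close>
  have "m \<noteq> 1" using assms(3,4,7,8) by (auto simp: field_simps)
  then have "equivalent_grid_points M B1 N m r X < 1 + real CARD('d) * ln (r m / r 1)"
    using equivalent_grid_points_less assms(2,5) by simp
  also have "r m / r 1 = lam" using assms(3,4,7,8) by simp
  finally show ?thesis .
qed

end
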